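(* The following six 5-dimensional subalgebras of $M_3(\mathbb{C})$ are pairwise neither isomorphic nor antiisomorphic: 1) $\mathrm{Span}\{e_{11},e_{22},e_{23},e_{32},e_{33}\}$; 2) $\mathrm{Span}\{e_{11},e_{12},e_{13},e_{22},e_{33}\}$; 3) $\mathrm{Span}\{e_{11},e_{12},e_{13},e_{23},e_{22}+e_{33}\}$; 4) $\mathrm{Span}\{e_{11},e_{12},e_{13},e_{22},e_{23}\}$; 5) $\mathrm{Span}\{e_{11},e_{12},e_{13},e_{23},e_{33}\}$; 6) $\mathrm{Span}\{e_{11}+e_{33},e_{12},e_{13},e_{22},e_{23}\}$.
   Context: $M_3(\mathbb{C})$ is the algebra of $3\times3$ complex matrices, $e_{ij}$ are the matrix units, and $\mathrm{Span}$ means linear span over $\mathbb{C}$. A subalgebra is a $\mathbb{C}$-linear subspace closed under multiplication; it is not required to contain the identity matrix. Isomorphic and antiisomorphic are meant as for (not necessarily unital) associative $\mathbb{C}$-algebras. *)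

theory Defs
  imports "HOL-Analysis.Analysis"
begin

text \<open>The scalar multiplications on matrices in the library are over the reals
  (\<^const>\<open>scaleR\<close>) or over rows (\<^const>\<open>vector_scalar_mult\<close>), so the complex
  vector space of complex matrices is set up here.\<close>

definition cmat_scale :: "complex \<Rightarrow> complex^'n^'m \<Rightarrow> complex^'n^'m" (infixr "*\<^sub>C" 75)
  where "c *\<^sub>C A = (\<chi> i j. c * A $ i $ j)"

global_interpretation cmat: vector_space "(*\<^sub>C) :: complex \<Rightarrow> complex^'n^'m \<Rightarrow> complex^'n^'m"
  by unfold_locales (simp_all add: cmat_scale_def vec_eq_iff algebra_simps)

definition matrix_unit :: "'n \<Rightarrow> 'n \<Rightarrow> complex^'n^'n"
  where "matrix_unit i j = (\<chi> k l. if k = i \<and> l = j then 1 else 0)"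

definition subalgebra :: "(complex^'n^'n) set \<Rightarrow> bool"
  where "subalgebra S \<longleftrightarrow> cmat.subspace S \<and> (\<forall>A\<in>S. \<forall>B\<in>S. A ** B \<in> S)"

definition linear_bij :: "(complex^'n^'n) set \<Rightarrow> (complex^'n^'n) set \<Rightarrow>
    (complex^'n^'n \<Rightarrow> complex^'n^'n) \<Rightarrow> bool"
  where "linear_bij S T f \<longleftrightarrow> bij_betw f S T \<and>
    (\<forall>A\<in>S. \<forall>B\<in>S. f (A + B) = f A + f B) \<and>
    (\<forall>c. \<forall>A\<in>S. f (c *\<^sub>C A) = c *\<^sub>C f A)"

definition algebra_isomorphic :: "(complex^'n^'n) set \<Rightarrow> (complex^'n^'n) set \<Rightarrow> bool"
  where "algebra_isomorphic S T \<longleftrightarrow>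
    (\<exists>f. linear_bij S T f \<and> (\<forall>A\<in>S. \<forall>B\<in>S. f (A ** B) = f A ** f B))"

definition algebra_antiisomorphic :: "(complex^'n^'n) set \<Rightarrow> (complex^'n^'n) set \<Rightarrow> bool"
  where "algebra_antiisomorphic S T \<longleftrightarrow>
    (\<exists>f. linear_bij S T f \<and> (\<forall>A\<in>S. \<forall>B\<in>S. f (A ** B) = f B ** f A))"

text \<open>The index type \<^typ>\<open>3\<close> consists of the residues modulo 3; its elements 1, 2, 3 are
  distinct, with 3 equal to 0, so the usual indexing from 1 is literally available.\<close>

abbreviation e :: "3 \<Rightarrow> 3 \<Rightarrow> complex^3^3"
  where "e \<equiv> matrix_unit"

definition five_dim_subalgebras :: "(complex^3^3) set list"
  where "five_dim_subalgebras =
   [cmat.span {e 1 1, e 2 2, e 2 3, e 3 2, e 3 3},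
    cmat.span {e 1 1, e 1 2, e 1 3, e 2 2, e 3 3},
    cmat.span {e 1 1, e 1 2, e 1 3, e 2 3, e 2 2 + e 3 3},
    cmat.span {e 1 1, e 1 2, e 1 3, e 2 2, e 2 3},
    cmat.span {e 1 1, e 1 2, e 1 3, e 2 3, e 3 3},
    cmat.span {e 1 1 + e 3 3, e 1 2, e 1 3, e 2 2, e 2 3}]"

end

theory Submission
  imports Defs
begin

text \<open>
  The algebras are told apart by five properties of an algebra that survive reversal of
  the multiplication, so that isomorphisms and antiisomorphisms are treated together.

  The first two concern units. In algebra 5 the diagonal entry at 2 vanishes, which leaves
  \<open>e 1 2\<close> without a right unit and \<open>e 2 3\<close> without a left one. Algebra 4 has the left
  unit \<open>e 1 1 + e 2 2\<close>, but no right unit, as its third diagonal entry vanishes.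
  The other four contain the identity matrix.

  These four are separated by their commutators. In algebras 2 and 3 every commutator
  is supported on the positions (1,2) and (1,3), so any two commutators have product
  zero. In algebra 6 commutators are still strictly upper triangular, hence of cube zero,
  but \<open>e 1 2\<close> and \<open>e 2 3\<close> are both commutators (up to sign) and have product \<open>e 1 3\<close>.
  In algebra 1, which contains a full algebra of matrices of order two, the commutator
  of \<open>e 2 3\<close> and \<open>e 3 2\<close> is the non-nilpotent matrix \<open>e 2 2 - e 3 3\<close>.

  Finally, algebras 2 and 3 differ in their nilpotent elements: in algebra 2 these lie in
  the radical spanned by \<open>e 1 2\<close> and \<open>e 1 3\<close>, whose square is zero, while algebra 3
  contains the nilpotent \<open>e 1 2 + e 2 3\<close>, whose square is \<open>e 1 3\<close>.

  The five properties are combined into one number, \<open>algebra_kind\<close>, which agrees on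
  (anti)isomorphic algebras (\<open>algebra_kind_invariant\<close>) and whose value on each algebra of
  the list is its position there (\<open>algebra_kind_nth\<close>); distinct positions therefore give
  algebras that are neither isomorphic nor antiisomorphic.
\<close>

section \<open>Computing with matrices of order three\<close>

lemma matrix_unit_entry: "matrix_unit i j $ k $ l = (if k = i \<and> l = j then 1 else 0)"
  by (simp add: matrix_unit_def)

lemma cmat_scale_entry: "(c *\<^sub>C A) $ i $ j = c * A $ i $ j"
  by (simp add: cmat_scale_def)

lemma mult_entry_3:
  fixes A B :: "complex^3^3"
  shows "(A ** B) $ i $ j = A $ i $ 1 * B $ 1 $ j + A $ i $ 2 * B $ 2 $ j + A $ i $ 3 * B $ 3 $ j"
  by (simp add: matrix_matrix_mult_def sum_3)

lemma matrix_eq_3: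
  fixes A B :: "complex^3^3"
  shows "A = B \<longleftrightarrow>
    A $ 1 $ 1 = B $ 1 $ 1 \<and> A $ 1 $ 2 = B $ 1 $ 2 \<and> A $ 1 $ 3 = B $ 1 $ 3 \<and>
    A $ 2 $ 1 = B $ 2 $ 1 \<and> A $ 2 $ 2 = B $ 2 $ 2 \<and> A $ 2 $ 3 = B $ 2 $ 3 \<and>
    A $ 3 $ 1 = B $ 3 $ 1 \<and> A $ 3 $ 2 = B $ 3 $ 2 \<and> A $ 3 $ 3 = B $ 3 $ 3"
  by (simp add: vec_eq_iff forall_3)

lemmas entry_simps = matrix_unit_entry cmat_scale_entry mult_entry_3 matrix_eq_3

text \<open>Each member of \<open>bs\<close> has a position at which it alone is nonzero, so it cannot
  lie in the span of the others, nor coincide with one of them.\<close>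

lemma dim_span_private_entries:
  fixes bs :: "(complex^'n^'m) list"
  assumes "\<forall>k<length bs. \<forall>l<length bs. bs ! l $ fst (ps ! k) $ snd (ps ! k) = 0 \<longleftrightarrow> l \<noteq> k"
  shows "cmat.dim (cmat.span (set bs)) = length bs"
proof -
  have "distinct bs"
    using assms unfolding distinct_conv_nth by metis
  moreover have "cmat.independent (set bs)"
  proof
    assume "cmat.dependent (set bs)"
    then obtain k where k: "k < length bs" "bs ! k \<in> cmat.span (set bs - {bs ! k})"
      by (auto simp: cmat.dependent_def in_set_conv_nth)
    let ?Z = "{A :: complex^'n^'m. A $ fst (ps ! k) $ snd (ps ! k) = 0}"
    have "cmat.subspace ?Z"
      by (auto simp: cmat.subspace_def cmat_scale_entry)
    moreover have "set bs - {bs ! k} \<subseteq> ?Z"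
      using assms k(1) by (auto simp: in_set_conv_nth)
    ultimately have "cmat.span (set bs - {bs ! k}) \<subseteq> ?Z"
      by (rule cmat.span_minimal[rotated])
    then show False
      using assms k by auto
  qed
  ultimately show ?thesis
    by (simp add: cmat.dim_eq_card_independent distinct_card)
qed

section \<open>The six algebras as sets of matrices with prescribed zeros and equal entries\<close>

lemma span_1:
  "A \<in> cmat.span {e 1 1, e 2 2, e 2 3, e 3 2, e 3 3} \<longleftrightarrow>
    A $ 1 $ 2 = 0 \<and> A $ 1 $ 3 = 0 \<and> A $ 2 $ 1 = 0 \<and> A $ 3 $ 1 = 0"
  by (auto simp: cmat.span_breakdown_eq entry_simps)

lemma span_2:
  "A \<in> cmat.span {e 1 1, e 1 2, e 1 3, e 2 2, e 3 3} \<longleftrightarrow>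
    A $ 2 $ 1 = 0 \<and> A $ 2 $ 3 = 0 \<and> A $ 3 $ 1 = 0 \<and> A $ 3 $ 2 = 0"
  by (auto simp: cmat.span_breakdown_eq entry_simps)

lemma span_3:
  "A \<in> cmat.span {e 1 1, e 1 2, e 1 3, e 2 3, e 2 2 + e 3 3} \<longleftrightarrow>
    A $ 2 $ 1 = 0 \<and> A $ 3 $ 1 = 0 \<and> A $ 3 $ 2 = 0 \<and> A $ 2 $ 2 = A $ 3 $ 3"
  by (auto simp: cmat.span_breakdown_eq entry_simps)

lemma span_4:
  "A \<in> cmat.span {e 1 1, e 1 2, e 1 3, e 2 2, e 2 3} \<longleftrightarrow>
    A $ 2 $ 1 = 0 \<and> A $ 3 $ 1 = 0 \<and> A $ 3 $ 2 = 0 \<and> A $ 3 $ 3 = 0"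
  by (auto simp: cmat.span_breakdown_eq entry_simps)

lemma span_5:
  "A \<in> cmat.span {e 1 1, e 1 2, e 1 3, e 2 3, e 3 3} \<longleftrightarrow>
    A $ 2 $ 1 = 0 \<and> A $ 3 $ 1 = 0 \<and> A $ 3 $ 2 = 0 \<and> A $ 2 $ 2 = 0"
  by (auto simp: cmat.span_breakdown_eq entry_simps)

lemma span_6:
  "A \<in> cmat.span {e 1 1 + e 3 3, e 1 2, e 1 3, e 2 2, e 2 3} \<longleftrightarrow>
    A $ 2 $ 1 = 0 \<and> A $ 3 $ 1 = 0 \<and> A $ 3 $ 2 = 0 \<and> A $ 1 $ 1 = A $ 3 $ 3"
  by (auto simp: cmat.span_breakdown_eq entry_simps)

lemmas span_simps = span_1 span_2 span_3 span_4 span_5 span_6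

lemma subalgebra_span_iff:
  "subalgebra (cmat.span B) \<longleftrightarrow> (\<forall>x\<in>cmat.span B. \<forall>y\<in>cmat.span B. x ** y \<in> cmat.span B)"
  by (simp add: subalgebra_def)

lemma five_dim_subalgebras_subalgebra:
  assumes "S \<in> set five_dim_subalgebras"
  shows "subalgebra S"
proof -
  have "\<forall>S\<in>set five_dim_subalgebras. subalgebra S"
    by (simp add: five_dim_subalgebras_def subalgebra_span_iff span_simps mult_entry_3)
  then show ?thesis
    using assms by blast
qed

lemma five_dim_subalgebras_dim:
  assumes "S \<in> set five_dim_subalgebras"
  shows "cmat.dim S = 5"
proof -
  have "cmat.dim (cmat.span {e 1 1, e 2 2, e 2 3, e 3 2, e 3 3}) = 5"
    using dim_span_private_entries
      [of "[e 1 1, e 2 2, e 2 3, e 3 2, e 3 3]"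
        "[(1, 1), (2, 2), (2, 3), (3, 2), (3, 3)]"]
    by (simp add: All_less_Suc entry_simps del: cmat.dim_span)
  moreover have "cmat.dim (cmat.span {e 1 1, e 1 2, e 1 3, e 2 2, e 3 3}) = 5"
    using dim_span_private_entries
      [of "[e 1 1, e 1 2, e 1 3, e 2 2, e 3 3]"
        "[(1, 1), (1, 2), (1, 3), (2, 2), (3, 3)]"]
    by (simp add: All_less_Suc entry_simps del: cmat.dim_span)
  moreover have "cmat.dim (cmat.span {e 1 1, e 1 2, e 1 3, e 2 3, e 2 2 + e 3 3}) = 5"
    using dim_span_private_entries
      [of "[e 1 1, e 1 2, e 1 3, e 2 3, e 2 2 + e 3 3]"
        "[(1, 1), (1, 2), (1, 3), (2, 3), (2, 2)]"]
    by (simp add: All_less_Suc entry_simps del: cmat.dim_span)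
  moreover have "cmat.dim (cmat.span {e 1 1, e 1 2, e 1 3, e 2 2, e 2 3}) = 5"
    using dim_span_private_entries
      [of "[e 1 1, e 1 2, e 1 3, e 2 2, e 2 3]"
        "[(1, 1), (1, 2), (1, 3), (2, 2), (2, 3)]"]
    by (simp add: All_less_Suc entry_simps del: cmat.dim_span)
  moreover have "cmat.dim (cmat.span {e 1 1, e 1 2, e 1 3, e 2 3, e 3 3}) = 5"
    using dim_span_private_entries
      [of "[e 1 1, e 1 2, e 1 3, e 2 3, e 3 3]"
        "[(1, 1), (1, 2), (1, 3), (2, 3), (3, 3)]"]
    by (simp add: All_less_Suc entry_simps del: cmat.dim_span)
  moreover have "cmat.dim (cmat.span {e 1 1 + e 3 3, e 1 2, e 1 3, e 2 2, e 2 3}) = 5"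
    using dim_span_private_entries
      [of "[e 1 1 + e 3 3, e 1 2, e 1 3, e 2 2, e 2 3]"
        "[(1, 1), (1, 2), (1, 3), (2, 2), (2, 3)]"]
    by (simp add: All_less_Suc entry_simps del: cmat.dim_span)
  ultimately show ?thesis
    using assms unfolding five_dim_subalgebras_def by (auto simp del: cmat.dim_span)
qed

section \<open>Invariants of an algebra up to isomorphism and antiisomorphism\<close>

definition iso_or_anti :: "(complex^'n^'n) set \<Rightarrow> (complex^'n^'n) set \<Rightarrow>
    (complex^'n^'n \<Rightarrow> complex^'n^'n) \<Rightarrow> bool"
  where "iso_or_anti S T f \<longleftrightarrow> linear_bij S T f \<and>
    ((\<forall>x\<in>S. \<forall>y\<in>S. f (x ** y) = f x ** f y) \<or> (\<forall>x\<in>S. \<forall>y\<in>S. f (x ** y) = f y ** f x))"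

definition commutator :: "complex^'n^'n \<Rightarrow> complex^'n^'n \<Rightarrow> complex^'n^'n"
  where "commutator x y = x ** y - y ** x"

definition has_one_sided_unit :: "(complex^'n^'n) set \<Rightarrow> bool"
  where "has_one_sided_unit S \<longleftrightarrow>
    (\<exists>u\<in>S. (\<forall>x\<in>S. u ** x = x) \<or> (\<forall>x\<in>S. x ** u = x))"

definition has_unit :: "(complex^'n^'n) set \<Rightarrow> bool"
  where "has_unit S \<longleftrightarrow> (\<exists>u\<in>S. \<forall>x\<in>S. u ** x = x \<and> x ** u = x)"

definition commutators_annihilate :: "(complex^'n^'n) set \<Rightarrow> bool"
  where "commutators_annihilate S \<longleftrightarrow>
    (\<forall>w\<in>S. \<forall>x\<in>S. \<forall>y\<in>S. \<forall>z\<in>S. commutator w x ** commutator y z = 0)"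

definition cube_zero :: "complex^'n^'n \<Rightarrow> bool"
  where "cube_zero x \<longleftrightarrow> x ** (x ** x) = 0"

definition commutators_cube_zero :: "(complex^'n^'n) set \<Rightarrow> bool"
  where "commutators_cube_zero S \<longleftrightarrow> (\<forall>x\<in>S. \<forall>y\<in>S. cube_zero (commutator x y))"

definition cube_zero_squares_zero :: "(complex^'n^'n) set \<Rightarrow> bool"
  where "cube_zero_squares_zero S \<longleftrightarrow> (\<forall>x\<in>S. cube_zero x \<longrightarrow> x ** x = 0)"

text \<open>The values are chosen as positions, counted from 0, in the list of the six algebras.\<close>

definition algebra_kind :: "(complex^'n^'n) set \<Rightarrow> nat"
  where "algebra_kind S =
    (if \<not> has_one_sided_unit S then 4
     else if \<not> has_unit S then 3
     else if commutators_annihilate S then (if cube_zero_squares_zero S then 1 else 2)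
     else (if commutators_cube_zero S then 5 else 0))"

lemma iso_or_anti_zero:
  assumes "iso_or_anti S T f" "subalgebra S"
  shows "f 0 = 0"
proof -
  have "0 \<in> S"
    using assms(2) by (simp add: subalgebra_def cmat.subspace_0)
  then have "f (0 + 0) = f 0 + f 0"
    using assms(1) unfolding iso_or_anti_def linear_bij_def by blast
  then show ?thesis by simp
qed

lemma iso_or_anti_eq_zero_iff:
  assumes "iso_or_anti S T f" "subalgebra S" "x \<in> S"
  shows "f x = 0 \<longleftrightarrow> x = 0"
proof -
  have "0 \<in> S" "inj_on f S"
    using assms by (auto simp: subalgebra_def cmat.subspace_0 iso_or_anti_def
        linear_bij_def bij_betw_def)
  then show ?thesis
    using iso_or_anti_zero[OF assms(1,2)] assms(3) by (metis inj_onD)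
qed

lemma iso_or_anti_diff:
  assumes f: "iso_or_anti S T f" and S: "subalgebra S" and "x \<in> S" "y \<in> S"
  shows "f (x - y) = f x - f y"
proof -
  have "x - y \<in> S"
    using assms by (simp add: subalgebra_def cmat.subspace_diff)
  then have "f ((x - y) + y) = f (x - y) + f y"
    using f \<open>y \<in> S\<close> unfolding iso_or_anti_def linear_bij_def by blast
  then show ?thesis by simp
qed

lemma subalgebra_mult: "subalgebra S \<Longrightarrow> x \<in> S \<Longrightarrow> y \<in> S \<Longrightarrow> x ** y \<in> S"
  by (simp add: subalgebra_def)

lemma subalgebra_commutator: "subalgebra S \<Longrightarrow> x \<in> S \<Longrightarrow> y \<in> S \<Longrightarrow> commutator x y \<in> S"
  by (simp add: subalgebra_def commutator_def cmat.subspace_diff)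

text \<open>With inverses available, it is enough to carry each property in one direction.\<close>

lemma iso_or_anti_inverse:
  assumes f: "iso_or_anti S T f" and S: "subalgebra S"
  shows "iso_or_anti T S (inv_into S f)"
proof -
  let ?g = "inv_into S f"
  have bij: "bij_betw f S T"
    using f by (simp add: iso_or_anti_def linear_bij_def)
  have g: "?g v \<in> S" "f (?g v) = v" if "v \<in> T" for v
    using bij that by (simp_all add: bij_betw_imp_surj_on bij_betw_inv_into_right inv_into_into)
  have gI: "?g v = x" if "x \<in> S" "f x = v" for x v
    using bij that by (auto simp: bij_betw_def)
  have "?g (v + w) = ?g v + ?g w" if "v \<in> T" "w \<in> T" for v w
    using f S g[OF that(1)] g[OF that(2)]
    by (intro gI) (auto simp: iso_or_anti_def linear_bij_def subalgebra_def cmat.subspace_add)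
  moreover have "?g (c *\<^sub>C v) = c *\<^sub>C ?g v" if "v \<in> T" for c v
    using f S g[OF that]
    by (intro gI) (auto simp: iso_or_anti_def linear_bij_def subalgebra_def cmat.subspace_scale)
  ultimately have "linear_bij T S ?g"
    using bij by (simp add: linear_bij_def bij_betw_inv_into)
  moreover have "(\<forall>v\<in>T. \<forall>w\<in>T. ?g (v ** w) = ?g v ** ?g w) \<or>
      (\<forall>v\<in>T. \<forall>w\<in>T. ?g (v ** w) = ?g w ** ?g v)"
    using f unfolding iso_or_anti_def
    by (elim conjE disjE) (auto intro!: gI simp: g subalgebra_mult[OF S])
  ultimately show ?thesis
    by (simp add: iso_or_anti_def)
qed

text \<open>An antiisomorphism exchanges the two terms of a commutator, that is, it only changes
  the sign. This is why vanishing conditions on commutators are invariant.\<close>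

lemma iso_or_anti_commutator:
  assumes f: "iso_or_anti S T f" and S: "subalgebra S" and x: "x \<in> S" and y: "y \<in> S"
  shows "f (commutator x y) = commutator (f x) (f y) \<or> f (commutator x y) = commutator (f y) (f x)"
  using f x y iso_or_anti_diff[OF f S, of "x ** y" "y ** x"] subalgebra_mult[OF S]
  by (auto simp: commutator_def iso_or_anti_def)

lemma iso_or_anti_square:
  assumes "iso_or_anti S T f" and "x \<in> S"
  shows "f (x ** x) = f x ** f x"
  using assms by (auto simp: iso_or_anti_def)

text \<open>Powers of a single element do not notice the order of the factors, so nilpotency
  is the same on both sides of an antiisomorphism.\<close>

lemma iso_or_anti_cube_zero:
  assumes f: "iso_or_anti S T f" and S: "subalgebra S" and x: "x \<in> S"
  shows "cube_zero (f x) \<longleftrightarrow> cube_zero x"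
proof -
  have xx: "x ** x \<in> S" and xxx: "x ** (x ** x) \<in> S"
    using x subalgebra_mult[OF S] by auto
  have "f (x ** (x ** x)) = f x ** (f x ** f x)"
  proof -
    have "f (x ** (x ** x)) = f x ** f (x ** x) \<or> f (x ** (x ** x)) = f (x ** x) ** f x"
      using f x xx unfolding iso_or_anti_def by blast
    then show ?thesis
      by (simp add: iso_or_anti_square[OF f x] matrix_mul_assoc)
  qed
  then show ?thesis
    using iso_or_anti_eq_zero_iff[OF f S xxx] by (simp add: cube_zero_def)
qed

lemma cube_zero_uminus: "cube_zero (- x) \<longleftrightarrow> cube_zero x"
proof -
  have "- x ** (- x ** - x) = - (x ** (x ** x))"
    by (simp add: matrix_matrix_mult_def vec_eq_iff sum_negf)
  then show ?thesis by (simp add: cube_zero_def)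
qed

lemma commutator_swap: "commutator y x = - commutator x y"
  by (simp add: commutator_def)

lemma iso_or_anti_image:
  assumes "iso_or_anti S T f"
  shows "T = f ` S"
  using assms by (simp add: iso_or_anti_def linear_bij_def bij_betw_def)

text \<open>An antiisomorphism turns a left unit into a right one and conversely, so the side
  of a one-sided unit is not preserved, whereas a two-sided unit stays two-sided.\<close>

lemma iso_or_anti_left_right_neutral:
  assumes f: "iso_or_anti S T f" and u: "u \<in> S"
  shows "(\<forall>x\<in>S. u ** x = x) \<Longrightarrow> (\<forall>y\<in>T. f u ** y = y) \<or> (\<forall>y\<in>T. y ** f u = y)"
    and "(\<forall>x\<in>S. x ** u = x) \<Longrightarrow> (\<forall>y\<in>T. f u ** y = y) \<or> (\<forall>y\<in>T. y ** f u = y)"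
    and "(\<forall>x\<in>S. u ** x = x \<and> x ** u = x) \<Longrightarrow> \<forall>y\<in>T. f u ** y = y \<and> y ** f u = y"
proof -
  consider (iso) "\<forall>x\<in>S. \<forall>y\<in>S. f x ** f y = f (x ** y)"
    | (anti) "\<forall>x\<in>S. \<forall>y\<in>S. f x ** f y = f (y ** x)"
    using f unfolding iso_or_anti_def by metis
  note cases = this
  show "(\<forall>y\<in>T. f u ** y = y) \<or> (\<forall>y\<in>T. y ** f u = y)" if "\<forall>x\<in>S. u ** x = x"
    using cases that u by cases (simp_all add: iso_or_anti_image[OF f])
  show "(\<forall>y\<in>T. f u ** y = y) \<or> (\<forall>y\<in>T. y ** f u = y)" if "\<forall>x\<in>S. x ** u = x"
    using cases that u by cases (simp_all add: iso_or_anti_image[OF f])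
  show "\<forall>y\<in>T. f u ** y = y \<and> y ** f u = y" if "\<forall>x\<in>S. u ** x = x \<and> x ** u = x"
    using cases that u by cases (simp_all add: iso_or_anti_image[OF f])
qed

lemma transfer_has_one_sided_unit:
  assumes f: "iso_or_anti S T f" and P: "has_one_sided_unit S"
  shows "has_one_sided_unit T"
proof -
  obtain u where u: "u \<in> S" "(\<forall>x\<in>S. u ** x = x) \<or> (\<forall>x\<in>S. x ** u = x)"
    using P unfolding has_one_sided_unit_def by blast
  then have "f u \<in> T"
    by (simp add: iso_or_anti_image[OF f])
  then show ?thesis
    using u(2) iso_or_anti_left_right_neutral(1,2)[OF f u(1)] unfolding has_one_sided_unit_def
    by blast
qed

lemma transfer_has_unit:
  assumes f: "iso_or_anti S T f" and P: "has_unit S"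
  shows "has_unit T"
proof -
  obtain u where u: "u \<in> S" "\<forall>x\<in>S. u ** x = x \<and> x ** u = x"
    using P unfolding has_unit_def by blast
  then have "f u \<in> T"
    by (simp add: iso_or_anti_image[OF f])
  then show ?thesis
    using iso_or_anti_left_right_neutral(3)[OF f u] unfolding has_unit_def by blast
qed

text \<open>An antiisomorphism also exchanges the two commutators that are multiplied; the
  hypothesis covers both orders.\<close>

lemma transfer_commutators_annihilate:
  assumes f: "iso_or_anti S T f" and S: "subalgebra S" and P: "commutators_annihilate S"
  shows "commutators_annihilate T"
  unfolding commutators_annihilate_def iso_or_anti_image[OF f]
proof (intro ballI, elim imageE, hypsubst)
  fix w x y z
  assume mem: "w \<in> S" "x \<in> S" "y \<in> S" "z \<in> S"
  let ?a = "commutator w x" and ?b = "commutator y z"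
  have "f (?a ** ?b) = 0" "f (?b ** ?a) = 0"
    using P mem iso_or_anti_zero[OF f S] by (simp_all add: commutators_annihilate_def)
  moreover have "?a \<in> S" "?b \<in> S"
    using mem subalgebra_commutator[OF S] by simp_all
  ultimately have prod0: "f ?a ** f ?b = 0"
    using f unfolding iso_or_anti_def by metis
  have sgn: "f ?a = commutator (f w) (f x) \<or> f ?a = - commutator (f w) (f x)"
    "f ?b = commutator (f y) (f z) \<or> f ?b = - commutator (f y) (f z)"
    using iso_or_anti_commutator[OF f S mem(1,2)] iso_or_anti_commutator[OF f S mem(3,4)]
      commutator_swap[of "f w" "f x"] commutator_swap[of "f y" "f z"] by auto
  have neg: "(- p) ** q = - (p ** q)" "p ** (- q) = - (p ** q)" for p q :: "complex^'a^'a"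
    by (simp_all add: matrix_matrix_mult_def vec_eq_iff sum_negf)
  show "commutator (f w) (f x) ** commutator (f y) (f z) = 0"
    using prod0 sgn by (auto simp: neg)
qed

lemma transfer_commutators_cube_zero:
  assumes f: "iso_or_anti S T f" and S: "subalgebra S" and P: "commutators_cube_zero S"
  shows "commutators_cube_zero T"
  unfolding commutators_cube_zero_def iso_or_anti_image[OF f]
proof (intro ballI, elim imageE, hypsubst)
  fix x y
  assume mem: "x \<in> S" "y \<in> S"
  have "cube_zero (f (commutator x y))"
    using P mem iso_or_anti_cube_zero[OF f S subalgebra_commutator[OF S mem]]
    by (simp add: commutators_cube_zero_def)
  then show "cube_zero (commutator (f x) (f y))"
    using iso_or_anti_commutator[OF f S mem] commutator_swap[of "f x" "f y"]
    by (auto simp: cube_zero_uminus)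
qed

lemma transfer_cube_zero_squares_zero:
  assumes f: "iso_or_anti S T f" and S: "subalgebra S" and P: "cube_zero_squares_zero S"
  shows "cube_zero_squares_zero T"
  unfolding cube_zero_squares_zero_def iso_or_anti_image[OF f]
proof (intro ballI impI, elim imageE, hypsubst)
  fix x
  assume x: "x \<in> S" and "cube_zero (f x)"
  then have "x ** x = 0"
    using P iso_or_anti_cube_zero[OF f S] by (simp add: cube_zero_squares_zero_def)
  then show "f x ** f x = 0"
    using iso_or_anti_square[OF f x] iso_or_anti_zero[OF f S] by simp
qed

lemma algebra_kind_invariant:
  assumes f: "iso_or_anti S T f" and S: "subalgebra S" and T: "subalgebra T"
  shows "algebra_kind S = algebra_kind T"
proof -
  note g = iso_or_anti_inverse[OF f S]
  have "has_one_sided_unit S = has_one_sided_unit T"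
    using transfer_has_one_sided_unit f g by blast
  moreover have "has_unit S = has_unit T"
    using transfer_has_unit f g by blast
  moreover have "commutators_annihilate S = commutators_annihilate T"
    using transfer_commutators_annihilate f g S T by blast
  moreover have "commutators_cube_zero S = commutators_cube_zero T"
    using transfer_commutators_cube_zero f g S T by blast
  moreover have "cube_zero_squares_zero S = cube_zero_squares_zero T"
    using transfer_cube_zero_squares_zero f g S T by blast
  ultimately show ?thesis
    by (simp add: algebra_kind_def)
qed

section \<open>The invariant separates the six algebras\<close>

lemma commutator_entry_3:
  fixes x y :: "complex^3^3"
  shows "commutator x y $ i $ j =
    x $ i $ 1 * y $ 1 $ j + x $ i $ 2 * y $ 2 $ j + x $ i $ 3 * y $ 3 $ j -
    (y $ i $ 1 * x $ 1 $ j + y $ i $ 2 * x $ 2 $ j + y $ i $ 3 * x $ 3 $ j)"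
  by (simp add: commutator_def mult_entry_3)

lemma cube_zero_strictly_upper:
  fixes x :: "complex^3^3"
  assumes "x $ 1 $ 1 = 0" "x $ 2 $ 1 = 0" "x $ 2 $ 2 = 0" "x $ 3 $ 1 = 0" "x $ 3 $ 2 = 0" "x $ 3 $ 3 = 0"
  shows "cube_zero x"
  using assms by (simp add: cube_zero_def entry_simps)

lemma has_unitI: "mat 1 \<in> S \<Longrightarrow> has_unit S"
  unfolding has_unit_def by (intro bexI[of _ "mat 1"]) simp_all

lemma has_unit_imp_one_sided: "has_unit S \<Longrightarrow> has_one_sided_unit S"
  by (auto simp: has_unit_def has_one_sided_unit_def)

lemma algebra_kind_1: "algebra_kind (cmat.span {e 1 1, e 2 2, e 2 3, e 3 2, e 3 3}) = 0"
  (is "algebra_kind ?S = 0")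
proof -
  have mem: "e 2 3 \<in> ?S" "e 3 2 \<in> ?S"
    by (simp_all add: span_simps entry_simps)
  have "has_unit ?S"
    by (rule has_unitI) (simp add: span_simps mat_def)
  moreover have "commutator (e 2 3) (e 3 2) ** commutator (e 2 3) (e 3 2) \<noteq> 0"
    by (simp add: entry_simps commutator_entry_3)
  then have "\<not> commutators_annihilate ?S"
    using mem unfolding commutators_annihilate_def by blast
  moreover have "\<not> cube_zero (commutator (e 2 3) (e 3 2))"
    by (simp add: entry_simps commutator_entry_3 cube_zero_def)
  then have "\<not> commutators_cube_zero ?S"
    using mem unfolding commutators_cube_zero_def by blast
  ultimately show ?thesis
    by (simp add: algebra_kind_def has_unit_imp_one_sided)
qed

lemma algebra_kind_2: "algebra_kind (cmat.span {e 1 1, e 1 2, e 1 3, e 2 2, e 3 3}) = 1"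
  (is "algebra_kind ?S = 1")
proof -
  have "has_unit ?S"
    by (rule has_unitI) (simp add: span_simps mat_def)
  moreover have "commutators_annihilate ?S"
    by (simp add: commutators_annihilate_def span_simps entry_simps commutator_entry_3)
  \<comment> \<open>A vanishing cube forces the diagonal to vanish, and then only the entries at (1,2)
    and (1,3) remain.\<close>
  moreover have "cube_zero_squares_zero ?S"
    by (auto simp: cube_zero_squares_zero_def cube_zero_def span_simps entry_simps)
  ultimately show ?thesis
    by (simp add: algebra_kind_def has_unit_imp_one_sided)
qed

lemma algebra_kind_3: "algebra_kind (cmat.span {e 1 1, e 1 2, e 1 3, e 2 3, e 2 2 + e 3 3}) = 2"
  (is "algebra_kind ?S = 2")
proof -
  have "has_unit ?S"
    by (rule has_unitI) (simp add: span_simps mat_def)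
  moreover have "commutators_annihilate ?S"
    by (simp add: commutators_annihilate_def span_simps entry_simps commutator_entry_3)
  moreover have "e 1 2 + e 2 3 \<in> ?S" "cube_zero (e 1 2 + e 2 3)"
      "(e 1 2 + e 2 3) ** (e 1 2 + e 2 3) \<noteq> 0"
    by (simp_all add: span_simps entry_simps cube_zero_def)
  then have "\<not> cube_zero_squares_zero ?S"
    unfolding cube_zero_squares_zero_def by blast
  ultimately show ?thesis
    by (simp add: algebra_kind_def has_unit_imp_one_sided)
qed

lemma algebra_kind_4: "algebra_kind (cmat.span {e 1 1, e 1 2, e 1 3, e 2 2, e 2 3}) = 3"
  (is "algebra_kind ?S = 3")
proof -
  have "e 1 1 + e 2 2 \<in> ?S" "\<forall>x\<in>?S. (e 1 1 + e 2 2) ** x = x"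
    by (simp_all add: span_simps entry_simps)
  then have "has_one_sided_unit ?S"
    unfolding has_one_sided_unit_def by blast
  moreover have "e 1 3 \<in> ?S" "\<forall>u\<in>?S. e 1 3 ** u \<noteq> e 1 3"
    by (simp_all add: span_simps entry_simps)
  then have "\<not> has_unit ?S"
    unfolding has_unit_def by blast
  ultimately show ?thesis
    by (simp add: algebra_kind_def)
qed

lemma algebra_kind_5: "algebra_kind (cmat.span {e 1 1, e 1 2, e 1 3, e 2 3, e 3 3}) = 4"
  (is "algebra_kind ?S = 4")
proof -
  have "e 1 2 \<in> ?S" "\<forall>u\<in>?S. e 1 2 ** u \<noteq> e 1 2"
    "e 2 3 \<in> ?S" "\<forall>u\<in>?S. u ** e 2 3 \<noteq> e 2 3"
    by (simp_all add: span_simps entry_simps)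
  then have "\<not> has_one_sided_unit ?S"
    unfolding has_one_sided_unit_def by blast
  then show ?thesis
    by (simp add: algebra_kind_def)
qed

lemma algebra_kind_6: "algebra_kind (cmat.span {e 1 1 + e 3 3, e 1 2, e 1 3, e 2 2, e 2 3}) = 5"
  (is "algebra_kind ?S = 5")
proof -
  have mem: "e 1 2 \<in> ?S" "e 2 2 \<in> ?S" "e 2 3 \<in> ?S"
    by (simp_all add: span_simps entry_simps)
  have "has_unit ?S"
    by (rule has_unitI) (simp add: span_simps mat_def)
  moreover have "commutator (e 1 2) (e 2 2) ** commutator (e 2 2) (e 2 3) \<noteq> 0"
    by (simp add: entry_simps commutator_entry_3)
  then have "\<not> commutators_annihilate ?S"
    using mem unfolding commutators_annihilate_def by blast
  moreover have "commutators_cube_zero ?S"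
    unfolding commutators_cube_zero_def
    by (intro ballI cube_zero_strictly_upper) (simp_all add: span_simps commutator_entry_3)
  ultimately show ?thesis
    by (simp add: algebra_kind_def has_unit_imp_one_sided)
qed

lemma algebra_kind_nth:
  assumes "i < 6"
  shows "algebra_kind (five_dim_subalgebras ! i) = i"
proof -
  have "i \<in> {0, 1, 2, 3, 4, 5}"
    using assms by auto
  then show ?thesis
    by (auto simp: five_dim_subalgebras_def algebra_kind_1 algebra_kind_2 algebra_kind_3
        algebra_kind_4 algebra_kind_5 algebra_kind_6)
qed

theorem mainTheorem10:
  shows "(\<forall>S \<in> set five_dim_subalgebras. subalgebra S \<and> cmat.dim S = 5) \<and>
    (\<forall>i<6. \<forall>j<6. i \<noteq> j \<longrightarrow>
      \<not> algebra_isomorphic (five_dim_subalgebras ! i) (five_dim_subalgebras ! j) \<and>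
      \<not> algebra_antiisomorphic (five_dim_subalgebras ! i) (five_dim_subalgebras ! j))"
proof (intro conjI ballI allI impI)
  fix S
  assume "S \<in> set five_dim_subalgebras"
  then show "subalgebra S" "cmat.dim S = 5"
    by (rule five_dim_subalgebras_subalgebra, rule five_dim_subalgebras_dim)
next
  fix i j :: nat
  assume ij: "i < 6" "j < 6" "i \<noteq> j"
  have "length five_dim_subalgebras = 6"
    by (simp add: five_dim_subalgebras_def)
  then have sub: "subalgebra (five_dim_subalgebras ! i)" "subalgebra (five_dim_subalgebras ! j)"
    using ij by (auto intro!: five_dim_subalgebras_subalgebra)
  have no: "\<not> iso_or_anti (five_dim_subalgebras ! i) (five_dim_subalgebras ! j) f" for f
    using algebra_kind_invariant[OF _ sub] algebra_kind_nth ij by metis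
  show "\<not> algebra_isomorphic (five_dim_subalgebras ! i) (five_dim_subalgebras ! j)"
    using no by (auto simp: algebra_isomorphic_def iso_or_anti_def)
  show "\<not> algebra_antiisomorphic (five_dim_subalgebras ! i) (five_dim_subalgebras ! j)"
    using no by (auto simp: algebra_antiisomorphic_def iso_or_anti_def)
qed

end
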